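(* Let $\lambda,\mu,\nu\vdash n$ be partitions such that $\ell(\lambda),\ell(\mu),\ell(\nu)\le k$. Then $$g(\lambda,\mu,\nu)\ \le\ n^{k^3}.$$
   Context: Here $n,k\ge 1$ are integers. For a partition $\lambda\vdash n$, $\ell(\lambda)$ denotes its length (number of nonzero parts). For $\lambda,\mu,\nu\vdash n$ the Kronecker coefficient is $g(\lambda,\mu,\nu)=\frac{1}{n!}\sum_{\sigma\in S_n}\chi^\lambda(\sigma)\chi^\mu(\sigma)\chi^\nu(\sigma)$, where $\chi^\alpha$ is the irreducible character of the symmetric group $S_n$ (Specht module) indexed by $\alpha\vdash n$. *)

theory Defs
  imports
    Complex_Main
    "HOL-Library.Function_Algebras"
    "HOL-Library.Complex_Order"
    "HOL-Combinatorics.Permutations"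
begin

definition is_partition :: "nat list \<Rightarrow> nat \<Rightarrow> bool"  (infix "\<turnstile>p" 50) where
  "\<alpha> \<turnstile>p n \<longleftrightarrow> sorted_wrt (\<ge>) \<alpha> \<and> 0 \<notin> set \<alpha> \<and> sum_list \<alpha> = n"

text \<open>A tableau is the list of its rows, each read from left to right; the entries are
  \<open>1, \<dots>, n\<close>, each used exactly once. No standardness is required.\<close>

definition tableaux :: "nat \<Rightarrow> nat list \<Rightarrow> nat list list set" where
  "tableaux n \<alpha> = {t. map length t = \<alpha> \<and> distinct (concat t) \<and> set (concat t) = {1..n}}"

definition column :: "nat list list \<Rightarrow> nat \<Rightarrow> nat set" where
  "column t j = {t ! i ! j | i. i < length t \<and> j < length (t ! i)}"

definition column_stabilizer :: "nat \<Rightarrow> nat list list \<Rightarrow> (nat \<Rightarrow> nat) set" where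
  "column_stabilizer n t = {\<pi>. \<pi> permutes {1..n} \<and> (\<forall>j. \<pi> ` column t j = column t j)}"

abbreviation permute_tableau :: "(nat \<Rightarrow> nat) \<Rightarrow> nat list list \<Rightarrow> nat list list" where
  "permute_tableau \<sigma> \<equiv> map (map \<sigma>)"

text \<open>The tabloid of \<open>t\<close>: the class of \<open>t\<close> under row equivalence.\<close>

definition tabloid :: "nat \<Rightarrow> nat list list \<Rightarrow> nat list list set" where
  "tabloid n t = {s \<in> tableaux n (map length t). map set s = map set t}"

text \<open>Formal complex linear combinations of tabloids are represented by their coefficient
  functions, with the pointwise vector space structure.\<close>

type_synonym tabloid_vec = "nat list list set \<Rightarrow> complex"

definition scale_fun :: "complex \<Rightarrow> ('a \<Rightarrow> complex) \<Rightarrow> 'a \<Rightarrow> complex" where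
  "scale_fun c v = (\<lambda>x. c * v x)"

global_interpretation fun_vs: vector_space "scale_fun :: complex \<Rightarrow> ('a \<Rightarrow> complex) \<Rightarrow> _"
  by standard (auto simp: scale_fun_def fun_eq_iff algebra_simps)

text \<open>The linear extension of \<open>\<sigma>\<cdot>{t} = {\<sigma>t}\<close>, which on coefficient functions reads
  \<open>(\<sigma>\<cdot>v) T = v (\<sigma>\<inverse>\<cdot>T)\<close>.\<close>

definition permute_vec :: "(nat \<Rightarrow> nat) \<Rightarrow> tabloid_vec \<Rightarrow> tabloid_vec" where
  "permute_vec \<sigma> v = (\<lambda>T. v (permute_tableau (inv \<sigma>) ` T))"

definition polytabloid :: "nat \<Rightarrow> nat list list \<Rightarrow> tabloid_vec" where
  "polytabloid n t =
     (\<lambda>T. \<Sum>\<pi>\<in>column_stabilizer n t.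
        of_int (sign \<pi>) * of_bool (T = tabloid n (permute_tableau \<pi> t)))"

definition specht :: "nat \<Rightarrow> nat list \<Rightarrow> tabloid_vec set" where
  "specht n \<alpha> = fun_vs.span (polytabloid n ` tableaux n \<alpha>)"

text \<open>The trace of a linear endomorphism \<open>f\<close> of a finite-dimensional subspace \<open>S\<close>, computed in
  some basis of \<open>S\<close>: the sum of the diagonal entries \<open>representation B (f b) b\<close>.\<close>

definition trace_on :: "('a \<Rightarrow> complex) set \<Rightarrow> (('a \<Rightarrow> complex) \<Rightarrow> ('a \<Rightarrow> complex)) \<Rightarrow> complex" where
  "trace_on S f =
     (let B = (SOME B. fun_vs.independent B \<and> fun_vs.span B = S)
      in \<Sum>b\<in>B. fun_vs.representation B (f b) b)"

definition irr_char :: "nat \<Rightarrow> nat list \<Rightarrow> (nat \<Rightarrow> nat) \<Rightarrow> complex" where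
  "irr_char n \<alpha> \<sigma> = trace_on (specht n \<alpha>) (permute_vec \<sigma>)"

definition kronecker :: "nat \<Rightarrow> nat list \<Rightarrow> nat list \<Rightarrow> nat list \<Rightarrow> complex" where
  "kronecker n lam mu nu =
     1 / fact n * (\<Sum>\<sigma> | \<sigma> permutes {1..n}. irr_char n lam \<sigma> * irr_char n mu \<sigma> * irr_char n nu \<sigma>)"

text \<open>Inequalities between such complex numbers use the order of \<open>Complex_Order\<close>: \<open>z \<le> w\<close> holds
  iff \<open>Re z \<le> Re w\<close> and \<open>Im z = Im w\<close>. So \<open>z \<le> of_nat m\<close> includes that \<open>z\<close> is real.\<close>

end

theory Submission
  imports Defs
begin

text \<open>
  The Kronecker coefficient is the dimension of the space of invariants of
  \<open>S\<^sup>\<lambda> \<otimes> S\<^sup>\<mu> \<otimes> S\<^sup>\<nu>\<close> under the diagonal action of the symmetric group. Each Specht module is a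
  subspace of the functions on tabloids of its shape, so these invariants embed into the invariant
  functions on triples of tabloids, whose dimension is the number of orbits of triples. A tabloid
  of shape \<open>\<lambda>\<close> is the same thing as a row assignment \<open>{1..n} \<rightarrow> {..<\<ell>(\<lambda>)}\<close> with prescribed fibre
  sizes, hence an orbit of triples is determined by how many elements are placed in each triple of
  rows, that is, by a three-dimensional contingency table with entry sum \<open>n\<close>. Such a table is a
  multiset of \<open>n\<close> cells out of \<open>K = \<ell>(\<lambda>) \<ell>(\<mu>) \<ell>(\<nu>) \<le> k\<^sup>3\<close>, so there are at most
  \<open>K + n - 1\<close> choose \<open>n\<close> of them, and this is at most \<open>n ^ K\<close> as soon as \<open>n \<ge> 2\<close> or \<open>K = 1\<close>. For \<open>n = 1\<close>
  every partition has a single part, and \<open>K = 1\<close>.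

  The dimension comparison is a computation with functions on triples of tabloids. A trace
  on an invariant subspace is \<open>\<Sum>c \<langle>c, \<sigma>c\<rangle>\<close> over any orthonormal basis (\<open>trace_on_orthonormal\<close>), and
  such bases exist by \<open>Gram_Schmidt\<close>. The products of the three bases form an orthonormal family \<open>e\<close>
  of functions on triples of tabloids, and the Kronecker coefficient becomes
  \<open>\<Sum>i \<langle>e i, P (e i)\<rangle>\<close>, where \<open>P\<close> averages over the group. Averaging over the group is averaging over
  orbits (\<open>group_average_eq_fibre_average\<close>), so the sum is the sum over all orbits \<open>O\<close> of
  \<open>\<Sum>i \<bar>\<langle>e i, 1\<^sub>O\<rangle>\<bar>\<^sup>2 / \<bar>O\<bar>\<close>. This is visibly real, and \<open>Bessel_inequality\<close> applied to the indicator
  \<open>1\<^sub>O\<close>, whose squared norm is \<open>\<bar>O\<bar>\<close>, bounds the contribution of each orbit by 1.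
\<close>

section \<open>Orthonormal families of functions\<close>

definition inner_on :: "'a set \<Rightarrow> ('a \<Rightarrow> complex) \<Rightarrow> ('a \<Rightarrow> complex) \<Rightarrow> complex" where
  "inner_on X u v = (\<Sum>x\<in>X. cnj (u x) * v x)"

text \<open>The family is indexed, so that it can be a basis given as a set (with \<open>e = id\<close>) as well as the
  family of products of three basis vectors.\<close>

definition orthonormal_on :: "'a set \<Rightarrow> 'i set \<Rightarrow> ('i \<Rightarrow> 'a \<Rightarrow> complex) \<Rightarrow> bool" where
  "orthonormal_on X I e \<longleftrightarrow> (\<forall>i\<in>I. \<forall>j\<in>I. inner_on X (e i) (e j) = of_bool (i = j))"

lemma inner_on_commute: "inner_on X v u = cnj (inner_on X u v)"
  by (simp add: inner_on_def mult.commute)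

lemma inner_on_diff_right: "inner_on X u (v - w) = inner_on X u v - inner_on X u w"
  by (simp add: inner_on_def algebra_simps sum_subtractf)

lemma inner_on_diff_left: "inner_on X (v - w) u = inner_on X v u - inner_on X w u"
  by (simp add: inner_on_def algebra_simps sum_subtractf)

lemma inner_on_zero_right: "inner_on X u 0 = 0"
  by (simp add: inner_on_def)

lemma inner_on_add_right: "inner_on X u (v + w) = inner_on X u v + inner_on X u w"
  by (simp add: inner_on_def algebra_simps sum.distrib)

lemma inner_on_scale_right: "inner_on X u (scale_fun c v) = c * inner_on X u v"
  by (simp add: inner_on_def scale_fun_def sum_distrib_left algebra_simps)

lemma inner_on_scale_left: "inner_on X (scale_fun c v) u = cnj c * inner_on X v u"
  by (simp add: inner_on_def scale_fun_def sum_distrib_left algebra_simps)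

lemma inner_on_sum_right: "inner_on X u (\<Sum>i\<in>I. v i) = (\<Sum>i\<in>I. inner_on X u (v i))"
  by (induction I rule: infinite_finite_induct)
    (simp_all only: sum.infinite sum.empty sum.insert inner_on_zero_right inner_on_add_right
      not_False_eq_True)

lemma inner_on_self: "inner_on X v v = of_real (\<Sum>x\<in>X. (cmod (v x))\<^sup>2)"
  by (simp add: inner_on_def mult.commute[of "cnj _"] complex_norm_square[symmetric])

lemma inner_on_orthonormal_sum:
  assumes "orthonormal_on X I e" "finite I" "j \<in> I"
  shows "inner_on X (e j) (\<Sum>i\<in>I. scale_fun (a i) (e i)) = a j"
proof -
  have "inner_on X (e j) (\<Sum>i\<in>I. scale_fun (a i) (e i)) = (\<Sum>i\<in>I. a i * inner_on X (e j) (e i))"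
    by (simp add: inner_on_sum_right inner_on_scale_right)
  also have "\<dots> = (\<Sum>i\<in>I. if i = j then a i else 0)"
    using assms by (intro sum.cong) (auto simp: orthonormal_on_def)
  finally show ?thesis using assms by simp
qed

text \<open>The gap between the two sides is the squared norm of \<open>f - g\<close>, where \<open>g\<close> is the orthogonal
  projection of \<open>f\<close> to the span of the family.\<close>

lemma Bessel_inequality:
  assumes "orthonormal_on X I e" "finite I"
  shows "(\<Sum>i\<in>I. (cmod (inner_on X (e i) f))\<^sup>2) \<le> (\<Sum>x\<in>X. (cmod (f x))\<^sup>2)"
proof -
  define a where "a = (\<lambda>i. inner_on X (e i) f)"
  define g where "g = (\<Sum>i\<in>I. scale_fun (a i) (e i))"
  define s where "s = (\<Sum>i\<in>I. (cmod (a i))\<^sup>2)"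
  have gj: "inner_on X (e i) g = a i" if "i \<in> I" for i
    using inner_on_orthonormal_sum[OF assms that] by (simp add: g_def)
  have sum_g: "inner_on X h g = (\<Sum>i\<in>I. a i * cnj (inner_on X (e i) h))" for h
    unfolding g_def inner_on_sum_right inner_on_scale_right
    by (intro sum.cong refl) (simp add: inner_on_commute[of X h])
  have gg: "inner_on X g g = of_real s"
    by (subst sum_g) (simp add: s_def gj complex_norm_square del: of_real_power)
  have fg: "inner_on X f g = of_real s"
    by (subst sum_g) (simp add: s_def a_def complex_norm_square del: of_real_power)
  have gf: "inner_on X g f = of_real s"
    using fg inner_on_commute[of X g f] by simp
  have "inner_on X (f - g) (f - g) = inner_on X f f - of_real s"
    by (simp add: inner_on_diff_left inner_on_diff_right gg fg gf)
  then have "complex_of_real (\<Sum>x\<in>X. (cmod ((f - g) x))\<^sup>2)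
      = complex_of_real ((\<Sum>x\<in>X. (cmod (f x))\<^sup>2) - s)"
    unfolding inner_on_self by (simp only: of_real_diff)
  then have "(\<Sum>x\<in>X. (cmod ((f - g) x))\<^sup>2) = (\<Sum>x\<in>X. (cmod (f x))\<^sup>2) - s"
    unfolding of_real_eq_iff .
  moreover have "0 \<le> (\<Sum>x\<in>X. (cmod ((f - g) x))\<^sup>2)"
    by (intro sum_nonneg) simp
  ultimately show ?thesis by (simp add: s_def a_def)
qed

lemma orthonormal_expansion:
  assumes "orthonormal_on X C id" "finite C" "v \<in> fun_vs.span C"
  shows "v = (\<Sum>c\<in>C. scale_fun (inner_on X c v) c)"
proof -
  obtain a where v: "v = (\<Sum>c\<in>C. scale_fun (a c) c)"
    using assms(3) unfolding fun_vs.span_finite[OF assms(2)] by auto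
  have "inner_on X c v = a c" if "c \<in> C" for c
    using inner_on_orthonormal_sum[OF assms(1,2) that, of a] by (simp add: v)
  then show ?thesis by (subst v) (auto intro: sum.cong)
qed

text \<open>\<open>inner_on X\<close> is definite only on functions that vanish outside \<open>X\<close>, whence the support
  condition: without it a nonzero remainder could have norm 0 and could not be normalized.\<close>

lemma Gram_Schmidt:
  assumes "finite X" "finite F" "\<And>v x. v \<in> F \<Longrightarrow> x \<notin> X \<Longrightarrow> v x = 0"
  shows "\<exists>C. finite C \<and> orthonormal_on X C id \<and> fun_vs.span C = fun_vs.span F"
  using assms(2,3)
proof (induction F rule: finite_induct)
  case empty
  show ?case by (intro exI[of _ "{}"]) (simp add: orthonormal_on_def)
next
  case (insert a F)
  have "\<exists>C. finite C \<and> orthonormal_on X C id \<and> fun_vs.span C = fun_vs.span F"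
    by (rule insert.IH) (use insert.prems in auto)
  then obtain C where C: "finite C" "orthonormal_on X C id" "fun_vs.span C = fun_vs.span F"
    by blast
  define p where "p = (\<Sum>c\<in>C. scale_fun (inner_on X c a) c)"
  define r where "r = a - p"
  have p: "p \<in> fun_vs.span C"
    unfolding p_def by (intro fun_vs.span_sum fun_vs.span_scale fun_vs.span_base)
  have span: "fun_vs.span (insert r C) = fun_vs.span (insert a F)"
    using fun_vs.eq_span_insert_eq[of a r C] p C(3)
    by (simp add: r_def fun_vs.span_insert)
  show ?case
  proof (cases "r = 0")
    case True
    then have "fun_vs.span C = fun_vs.span (insert a F)"
      using span by (metis fun_vs.span_insert_0)
    then show ?thesis using C by blast
  next
    case False
    have orth: "inner_on X c r = 0" if "c \<in> C" for c
      using inner_on_orthonormal_sum[OF C(2,1) that, of "\<lambda>c. inner_on X c a"]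
      by (simp add: r_def p_def inner_on_diff_right)
    have supp: "v x = 0" if "v \<in> fun_vs.span (insert a F)" "x \<notin> X" for v x
      using that(1)
      by (induction rule: fun_vs.span_induct)
        (use insert.prems that(2) in \<open>auto simp: fun_vs.subspace_def scale_fun_def\<close>)
    have "r \<in> fun_vs.span (insert a F)"
      using fun_vs.span_base[of r "insert r C"] span by simp
    then obtain x where "x \<in> X" "r x \<noteq> 0"
      using False supp by (metis ext zero_fun_apply)
    then have pos: "0 < (\<Sum>x\<in>X. (cmod (r x))\<^sup>2)" (is "0 < ?N")
      by (intro sum_pos2[OF assms(1), of x]) auto
    define s where "s = complex_of_real (1 / sqrt ?N)"
    define d where "d = scale_fun s r"
    have "cnj s * s = of_real (1 / ?N)"
      using pos unfolding s_def complex_cnj_complex_of_real of_real_mult[symmetric]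
      by (simp add: real_sqrt_mult[symmetric] less_imp_le)
    moreover have "inner_on X d d = (cnj s * s) * of_real ?N"
      unfolding inner_on_self[of X r, symmetric]
      by (simp only: d_def inner_on_scale_left inner_on_scale_right mult.assoc mult.left_commute)
    ultimately have "inner_on X d d = of_real (1 / ?N * ?N)"
      by (simp only: of_real_mult)
    then have dd: "inner_on X d d = 1"
      using pos by simp
    have cd: "inner_on X c d = 0" if "c \<in> C" for c
      using orth[OF that] by (simp add: d_def inner_on_scale_right)
    then have dc: "inner_on X d c = 0" if "c \<in> C" for c
      using that inner_on_commute[of X d c] by simp
    have "d \<notin> C" using cd dd by force
    then have on: "orthonormal_on X (insert d C) id"
      using C(2) dd cd dc by (auto simp: orthonormal_on_def)
    have "s \<noteq> 0" using pos by (simp add: s_def)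
    then have "fun_vs.span (insert d C) = fun_vs.span (insert r C)"
    proof -
      assume "s \<noteq> 0"
      then have "r = scale_fun (1 / s) d" by (simp add: d_def)
      then have "r \<in> fun_vs.span (insert d C)"
        by (metis fun_vs.span_base fun_vs.span_scale insertI1)
      moreover have "d \<in> fun_vs.span (insert r C)"
        unfolding d_def by (intro fun_vs.span_scale fun_vs.span_base) simp
      ultimately show ?thesis
        unfolding fun_vs.span_eq by (auto intro: fun_vs.span_base)
    qed
    then have "fun_vs.span (insert d C) = fun_vs.span (insert a F)" using span by simp
    then show ?thesis using on C(1) by (metis finite_insert)
  qed
qed

section \<open>Traces in orthonormal bases\<close>

text \<open>The basis in the definition of \<open>trace_on\<close> is an arbitrary choice, and this evaluates
  the trace in the basis \<open>C\<close> instead. Expanding each \<open>c\<close> in the chosen basis \<open>B\<close> turns the right-hand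
  side into a double sum over \<open>B \<times> C\<close>; summing over \<open>C\<close> first reassembles \<open>f b\<close> from its orthonormal
  expansion and leaves its diagonal coefficient.\<close>

lemma trace_on_orthonormal:
  assumes "orthonormal_on X C id" "finite C"
    and lin: "Vector_Spaces.linear scale_fun scale_fun f"
    and inv: "\<And>v. v \<in> fun_vs.span C \<Longrightarrow> f v \<in> fun_vs.span C"
  shows "trace_on (fun_vs.span C) f = (\<Sum>c\<in>C. inner_on X c (f c))"
proof -
  interpret f: Vector_Spaces.linear scale_fun scale_fun f by (rule lin)
  define S where "S = fun_vs.span C"
  define B where "B = (SOME B. fun_vs.independent B \<and> fun_vs.span B = S)"
  obtain B0 where "B0 \<subseteq> S" "fun_vs.independent B0" "S \<subseteq> fun_vs.span B0"
    using fun_vs.maximal_independent_subset by blast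
  then have "fun_vs.independent B0 \<and> fun_vs.span B0 = S"
    using fun_vs.span_minimal[of B0 S] by (auto simp: S_def)
  then have B: "fun_vs.independent B \<and> fun_vs.span B = S"
    unfolding B_def by (rule someI)
  have "B \<subseteq> fun_vs.span C" using B fun_vs.span_superset by (auto simp: S_def)
  then have finB: "finite B" using fun_vs.independent_span_bound assms(2) B by blast
  have CS: "c \<in> S" if "c \<in> C" for c using that by (simp add: S_def fun_vs.span_base)
  let ?R = "fun_vs.representation B"
  have "(\<Sum>c\<in>C. inner_on X c (f c)) = (\<Sum>c\<in>C. \<Sum>b\<in>B. ?R c b * inner_on X c (f b))"
  proof (intro sum.cong refl)
    fix c assume c: "c \<in> C"
    have "c = (\<Sum>b\<in>B. scale_fun (?R c b) b)"
      using fun_vs.sum_representation_eq[of B c B] B finB CS[OF c] by simp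
    then have "f c = f (\<Sum>b\<in>B. scale_fun (?R c b) b)" by (rule arg_cong)
    then have "inner_on X c (f c) = inner_on X c (\<Sum>b\<in>B. scale_fun (?R c b) (f b))"
      by (simp add: f.sum f.scale)
    then show "inner_on X c (f c) = (\<Sum>b\<in>B. ?R c b * inner_on X c (f b))"
      by (simp add: inner_on_sum_right inner_on_scale_right)
  qed
  also have "\<dots> = (\<Sum>b\<in>B. \<Sum>c\<in>C. inner_on X c (f b) * ?R c b)"
    by (subst sum.swap) (simp add: mult.commute)
  also have "\<dots> = (\<Sum>b\<in>B. ?R (f b) b)"
  proof (intro sum.cong refl)
    fix b assume "b \<in> B"
    then have "b \<in> fun_vs.span C" using \<open>B \<subseteq> fun_vs.span C\<close> by blast
    then have "f b = (\<Sum>c\<in>C. scale_fun (inner_on X c (f b)) c)"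
      by (intro orthonormal_expansion assms inv)
    then have "?R (f b) = ?R (\<Sum>c\<in>C. scale_fun (inner_on X c (f b)) c)" by (rule arg_cong)
    also have "\<dots> = (\<lambda>b'. \<Sum>c\<in>C. inner_on X c (f b) * ?R c b')"
    proof -
      have "c \<in> fun_vs.span B" if "c \<in> C" for c using CS[OF that] B by simp
      moreover have "fun_vs.independent B" using B by simp
      ultimately show ?thesis
        by (simp add: fun_vs.representation_sum fun_vs.representation_scale fun_vs.span_scale)
    qed
    finally show "(\<Sum>c\<in>C. inner_on X c (f b) * ?R c b) = ?R (f b) b" by simp
  qed
  finally show ?thesis by (simp add: trace_on_def B_def S_def Let_def)
qed

section \<open>Averaging over the symmetric group\<close>

text \<open>The symmetric group on \<open>A\<close> acts on \<open>W\<close>, and \<open>J\<close> is a complete invariant of the orbits. Orbits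
  are thus represented as fibres of \<open>J\<close>.\<close>

locale permutation_action =
  fixes A :: "'a set" and W :: "'w set" and act :: "('a \<Rightarrow> 'a) \<Rightarrow> 'w \<Rightarrow> 'w" and J :: "'w \<Rightarrow> 'c"
  assumes finite_A: "finite A" and finite_W: "finite W"
    and act_id: "w \<in> W \<Longrightarrow> act id w = w"
    and act_comp: "\<sigma> permutes A \<Longrightarrow> \<tau> permutes A \<Longrightarrow> w \<in> W \<Longrightarrow> act (\<sigma> \<circ> \<tau>) w = act \<sigma> (act \<tau> w)"
    and act_closed: "\<sigma> permutes A \<Longrightarrow> w \<in> W \<Longrightarrow> act \<sigma> w \<in> W"
    and J_act: "\<sigma> permutes A \<Longrightarrow> w \<in> W \<Longrightarrow> J (act \<sigma> w) = J w"
    and J_transitive: "w \<in> W \<Longrightarrow> w' \<in> W \<Longrightarrow> J w = J w' \<Longrightarrow> \<exists>\<sigma>. \<sigma> permutes A \<and> act \<sigma> w = w'"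
begin

abbreviation fibre :: "'c \<Rightarrow> 'w set" where
  "fibre c \<equiv> {w \<in> W. J w = c}"

lemma finite_fibre: "finite (fibre c)"
  using finite_W by simp

lemma sum_fibre_act:
  assumes "\<sigma> permutes A"
  shows "(\<Sum>w\<in>fibre c. h (act \<sigma> w)) = (\<Sum>w\<in>fibre c. h w)"
proof -
  have inv: "inv \<sigma> permutes A" using assms by (rule permutes_inv)
  show ?thesis
    by (rule sum.reindex_bij_witness[of _ "act (inv \<sigma>)" "act \<sigma>"])
      (use assms inv in \<open>auto simp: act_closed J_act act_id
        permutes_inv_o simp flip: act_comp\<close>)
qed

text \<open>The group average of \<open>h\<close> is constant along the orbit of \<open>w\<close>, by translating the summation
  variable. Summing it over the orbit and exchanging the sums, each group element merely permutes
  the orbit.\<close>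

lemma group_average_eq_fibre_average:
  fixes h :: "'w \<Rightarrow> complex"
  assumes w: "w \<in> W"
  shows "(\<Sum>\<sigma> | \<sigma> permutes A. h (act (inv \<sigma>) w)) / fact (card A)
    = (\<Sum>u\<in>fibre (J w). h u) / of_nat (card (fibre (J w)))"
proof -
  define a where "a = (\<lambda>w. \<Sum>\<sigma> | \<sigma> permutes A. h (act \<sigma> w))"
  have const: "a u = a w" if "u \<in> fibre (J w)" for u
  proof -
    have "u \<in> W" "J w = J u" using that by auto
    then obtain \<tau> where \<tau>: "\<tau> permutes A" "act \<tau> w = u"
      using J_transitive[OF w] by blast
    have "a w = (\<Sum>\<sigma> | \<sigma> permutes A. h (act (\<sigma> \<circ> \<tau>) w))"
      unfolding a_def by (rule sum_permutations_compose_right[OF \<tau>(1)])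
    also have "\<dots> = a u"
      unfolding a_def by (intro sum.cong refl) (use \<tau> w in \<open>simp add: act_comp\<close>)
    finally show ?thesis by simp
  qed
  have "of_nat (card (fibre (J w))) * a w = (\<Sum>u\<in>fibre (J w). a u)"
    using const by simp
  also have "\<dots> = (\<Sum>\<sigma> | \<sigma> permutes A. \<Sum>u\<in>fibre (J w). h (act \<sigma> u))"
    unfolding a_def by (rule sum.swap)
  also have "\<dots> = fact (card A) * (\<Sum>u\<in>fibre (J w). h u)"
    using card_permutations[OF refl finite_A] by (simp add: sum_fibre_act)
  finally have "of_nat (card (fibre (J w))) * a w = fact (card A) * (\<Sum>u\<in>fibre (J w). h u)" .
  moreover have "card (fibre (J w)) \<noteq> 0"
    using w finite_fibre[of "J w"] by auto
  moreover have "(\<Sum>\<sigma> | \<sigma> permutes A. h (act (inv \<sigma>) w)) = a w"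
    unfolding a_def by (rule sum_permutations_inverse[symmetric])
  ultimately show ?thesis
    by (simp add: field_simps)
qed

text \<open>In this form the average is seen to be real, and it involves \<open>b\<close> only through its inner products
  with the indicators of the orbits.\<close>

lemma average_inner_eq:
  "(\<Sum>\<sigma> | \<sigma> permutes A. inner_on W b (\<lambda>w. b (act (inv \<sigma>) w))) / fact (card A)
    = of_real (\<Sum>c\<in>J ` W. (cmod (\<Sum>w\<in>fibre c. b w))\<^sup>2 / real (card (fibre c)))"
proof -
  have "(\<Sum>\<sigma> | \<sigma> permutes A. inner_on W b (\<lambda>w. b (act (inv \<sigma>) w))) / fact (card A)
      = (\<Sum>w\<in>W. cnj (b w) * ((\<Sum>\<sigma> | \<sigma> permutes A. b (act (inv \<sigma>) w)) / fact (card A)))"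
    unfolding inner_on_def by (subst sum.swap) (simp add: sum_divide_distrib sum_distrib_left)
  also have "\<dots> = (\<Sum>w\<in>W. cnj (b w) * ((\<Sum>u\<in>fibre (J w). b u) / of_nat (card (fibre (J w)))))"
    by (intro sum.cong refl) (simp only: group_average_eq_fibre_average)
  also have "\<dots> = (\<Sum>c\<in>J ` W. \<Sum>w\<in>fibre c. cnj (b w) * ((\<Sum>u\<in>fibre (J w). b u) / of_nat (card (fibre (J w)))))"
    by (rule sum.image_gen[OF finite_W])
  also have "\<dots> = (\<Sum>c\<in>J ` W. of_real ((cmod (\<Sum>w\<in>fibre c. b w))\<^sup>2 / real (card (fibre c))))"
  proof (intro sum.cong refl)
    fix c
    have "(\<Sum>w\<in>fibre c. cnj (b w) * ((\<Sum>u\<in>fibre (J w). b u) / of_nat (card (fibre (J w)))))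
        = (\<Sum>w\<in>fibre c. cnj (b w)) * ((\<Sum>u\<in>fibre c. b u) / of_nat (card (fibre c)))"
      by (simp add: sum_distrib_right sum_divide_distrib)
    also have "\<dots> = of_real ((cmod (\<Sum>w\<in>fibre c. b w))\<^sup>2 / real (card (fibre c)))"
      by (simp add: complex_norm_square mult.commute del: of_real_power)
    finally show "(\<Sum>w\<in>fibre c. cnj (b w) * ((\<Sum>u\<in>fibre (J w). b u) / of_nat (card (fibre (J w)))))
        = of_real ((cmod (\<Sum>w\<in>fibre c. b w))\<^sup>2 / real (card (fibre c)))" .
  qed
  finally show ?thesis by simp
qed

text \<open>If \<open>e\<close> is an orthonormal basis of an invariant subspace, the left-hand side is the dimension of
  the invariants in that subspace, and \<open>card (J ` W)\<close> is the number of orbits, which is the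
  dimension of the invariants among all functions on \<open>W\<close>. Orbit by orbit, the bound is Bessel's
  inequality for the indicator of the orbit.\<close>

lemma invariant_dimension_le_fibres:
  assumes e: "orthonormal_on W I e" "finite I"
  shows "(\<Sum>\<sigma> | \<sigma> permutes A. \<Sum>i\<in>I. inner_on W (e i) (\<lambda>w. e i (act (inv \<sigma>) w))) / fact (card A)
    \<le> of_nat (card (J ` W))"
proof -
  define r where "r = (\<Sum>i\<in>I. \<Sum>c\<in>J ` W. (cmod (\<Sum>w\<in>fibre c. e i w))\<^sup>2 / real (card (fibre c)))"
  have "(\<Sum>\<sigma> | \<sigma> permutes A. \<Sum>i\<in>I. inner_on W (e i) (\<lambda>w. e i (act (inv \<sigma>) w))) / fact (card A)
      = (\<Sum>i\<in>I. (\<Sum>\<sigma> | \<sigma> permutes A. inner_on W (e i) (\<lambda>w. e i (act (inv \<sigma>) w))) / fact (card A))"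
    by (subst sum.swap) (simp add: sum_divide_distrib)
  also have "\<dots> = of_real r"
    unfolding average_inner_eq r_def by simp
  finally have eq: "(\<Sum>\<sigma> | \<sigma> permutes A. \<Sum>i\<in>I. inner_on W (e i) (\<lambda>w. e i (act (inv \<sigma>) w))) / fact (card A)
      = of_real r" .
  have "r = (\<Sum>c\<in>J ` W. (\<Sum>i\<in>I. (cmod (\<Sum>w\<in>fibre c. e i w))\<^sup>2) / real (card (fibre c)))"
    unfolding r_def by (subst sum.swap) (simp add: sum_divide_distrib)
  also have "\<dots> \<le> (\<Sum>c\<in>J ` W. 1)"
  proof (intro sum_mono)
    fix c
    (* The inner product with the indicator of the fibre is the sum over the fibre, up to conjugation. *)
    have "cmod (inner_on W (e i) (\<lambda>w. of_bool (J w = c))) = cmod (\<Sum>w\<in>fibre c. e i w)" for i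
    proof -
      have "inner_on W (e i) (\<lambda>w. of_bool (J w = c)) = cnj (\<Sum>w\<in>fibre c. e i w)"
        using finite_W by (simp add: inner_on_def Int_def)
      then show ?thesis by (simp only: complex_mod_cnj)
    qed
    then have "(\<Sum>i\<in>I. (cmod (\<Sum>w\<in>fibre c. e i w))\<^sup>2) \<le> (\<Sum>w\<in>W. (cmod (of_bool (J w = c)))\<^sup>2)"
      using Bessel_inequality[OF e, of "\<lambda>w. of_bool (J w = c)"] by simp
    also have "\<dots> = (\<Sum>w\<in>W. of_bool (J w = c))"
      by (intro sum.cong refl) simp
    also have "\<dots> = real (card (fibre c))"
      using finite_W by (simp add: Int_def)
    finally show "(\<Sum>i\<in>I. (cmod (\<Sum>w\<in>fibre c. e i w))\<^sup>2) / real (card (fibre c)) \<le> 1"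
      by (cases "real (card (fibre c)) = 0") (simp_all only: divide_le_eq_1_pos of_nat_0_less_iff
        neq0_conv of_nat_eq_0_iff div_by_0 of_nat_0 zero_le_one)
  qed
  finally have "r \<le> real (card (J ` W))" by simp
  then show ?thesis unfolding eq by (simp add: less_eq_complex_def)
qed

end

section \<open>The symmetric group acting on tabloids\<close>

lemma permute_tableau_comp: "permute_tableau (\<sigma> \<circ> \<tau>) t = permute_tableau \<sigma> (permute_tableau \<tau> t)"
  by simp

lemma permute_tableau_tabloids_comp:
  "permute_tableau (\<sigma> \<circ> \<tau>) ` T = permute_tableau \<sigma> ` permute_tableau \<tau> ` T"
  by (simp add: image_image)

lemma permute_tableau_inv:
  assumes "\<sigma> permutes A"
  shows "permute_tableau (inv \<sigma>) (permute_tableau \<sigma> t) = t"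
    and "permute_tableau \<sigma> (permute_tableau (inv \<sigma>) t) = t"
  using permutes_inv_o[OF assms] by simp_all

lemma permute_tableau_image_inv_eq_iff:
  assumes "\<sigma> permutes A"
  shows "permute_tableau (inv \<sigma>) ` T = U \<longleftrightarrow> T = permute_tableau \<sigma> ` U"
  using permute_tableau_inv[OF assms] by (auto simp: image_image simp del: map_map)

lemma permute_tableau_in_tableaux:
  assumes "\<sigma> permutes {1..n}" "t \<in> tableaux n \<alpha>"
  shows "permute_tableau \<sigma> t \<in> tableaux n \<alpha>"
proof -
  have "concat (permute_tableau \<sigma> t) = map \<sigma> (concat t)" by (rule map_concat[symmetric])
  moreover have "distinct (map \<sigma> (concat t))"
    using assms(2) permutes_inj_on[OF assms(1)] by (simp only: tableaux_def mem_Collect_eq distinct_map)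
  moreover have "set (map \<sigma> (concat t)) = {1..n}"
    using assms(2) permutes_image[OF assms(1)] by (simp only: tableaux_def mem_Collect_eq set_map)
  moreover have "map length (permute_tableau \<sigma> t) = \<alpha>"
    using assms(2) by (simp add: tableaux_def comp_def)
  ultimately show ?thesis
    by (simp only: tableaux_def mem_Collect_eq)
qed

lemma permute_tableau_tabloid:
  assumes "\<sigma> permutes {1..n}"
  shows "permute_tableau \<sigma> ` tabloid n t = tabloid n (permute_tableau \<sigma> t)"
proof -
  have sub: "permute_tableau \<tau> ` tabloid n s \<subseteq> tabloid n (permute_tableau \<tau> s)"
    if \<tau>: "\<tau> permutes {1..n}" for \<tau> s
  proof
    fix u assume "u \<in> permute_tableau \<tau> ` tabloid n s"
    then obtain v where v: "u = permute_tableau \<tau> v" "v \<in> tableaux n (map length s)"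
      "map set v = map set s" by (auto simp: tabloid_def)
    have "map set u = map ((`) \<tau>) (map set v)" by (simp add: v(1))
    also have "\<dots> = map set (permute_tableau \<tau> s)" unfolding v(3) by simp
    finally have "map set u = map set (permute_tableau \<tau> s)" .
    moreover have "u \<in> tableaux n (map length (permute_tableau \<tau> s))"
      using permute_tableau_in_tableaux[OF \<tau> v(2)] by (simp add: v(1) comp_def)
    ultimately show "u \<in> tabloid n (permute_tableau \<tau> s)"
      unfolding tabloid_def by simp
  qed
  have "tabloid n (permute_tableau \<sigma> t)
      = permute_tableau \<sigma> ` permute_tableau (inv \<sigma>) ` tabloid n (permute_tableau \<sigma> t)"
    unfolding image_image permute_tableau_inv[OF assms] by simp
  also have "\<dots> \<subseteq> permute_tableau \<sigma> ` tabloid n t"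
    using sub[OF permutes_inv[OF assms], of "permute_tableau \<sigma> t"]
    unfolding permute_tableau_inv[OF assms] by (rule image_mono)
  finally show ?thesis using sub[OF assms, of t] by blast
qed

lemma column_permute_tableau: "column (permute_tableau \<sigma> t) j = \<sigma> ` column t j"
proof -
  have "column (permute_tableau \<sigma> t) j = {\<sigma> (t ! i ! j) | i. i < length t \<and> j < length (t ! i)}"
    unfolding column_def by (intro Collect_cong ex_cong1) auto
  then show ?thesis by (auto simp: column_def)
qed

text \<open>Columns move along with the tableau, so the column stabilizer of \<open>\<sigma>t\<close> is the conjugate by \<open>\<sigma>\<close>
  of that of \<open>t\<close>. With \<open>sign_conj\<close> this gives the equivariance of polytabloids, and hence the
  invariance of the Specht module.\<close>

lemma column_stabilizer_conj:
  assumes \<sigma>: "\<sigma> permutes {1..n}" and \<pi>: "\<pi> \<in> column_stabilizer n t"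
  shows "\<sigma> \<circ> \<pi> \<circ> inv \<sigma> \<in> column_stabilizer n (permute_tableau \<sigma> t)"
proof -
  have "\<sigma> \<circ> \<pi> \<circ> inv \<sigma> permutes {1..n}"
    using assms by (intro permutes_compose permutes_inv) (auto simp: column_stabilizer_def)
  moreover have "(\<sigma> \<circ> \<pi> \<circ> inv \<sigma>) ` \<sigma> ` column t j = \<sigma> ` column t j" for j
  proof -
    have "(\<sigma> \<circ> \<pi> \<circ> inv \<sigma>) ` \<sigma> ` column t j = \<sigma> ` \<pi> ` column t j"
      using permutes_inverses[OF \<sigma>] by (simp add: image_image)
    also have "\<pi> ` column t j = column t j" using \<pi> by (simp add: column_stabilizer_def)
    finally show ?thesis .
  qed
  ultimately show ?thesis by (simp add: column_stabilizer_def column_permute_tableau)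
qed

lemma sign_conj:
  assumes "\<sigma> permutes A" "\<pi> permutes A" "finite A"
  shows "sign (\<sigma> \<circ> \<pi> \<circ> inv \<sigma>) = sign \<pi>"
proof -
  have "permutation \<sigma>" "permutation \<pi>"
    using assms permutes_imp_permutation by auto
  then show ?thesis
    by (simp add: sign_compose sign_inverse permutation_compose permutation_inverse mult.commute
      mult.left_commute)
qed

lemma permute_vec_polytabloid:
  assumes \<sigma>: "\<sigma> permutes {1..n}"
  shows "permute_vec \<sigma> (polytabloid n t) = polytabloid n (permute_tableau \<sigma> t)"
proof
  fix T
  have "permute_vec \<sigma> (polytabloid n t) T = (\<Sum>\<pi>\<in>column_stabilizer n t.
      of_int (sign \<pi>) * of_bool (T = tabloid n (permute_tableau (\<sigma> \<circ> \<pi>) t)))"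
    unfolding permute_vec_def polytabloid_def permute_tableau_image_inv_eq_iff[OF \<sigma>]
      permute_tableau_tabloid[OF \<sigma>] permute_tableau_comp ..
  also have "\<dots> = (\<Sum>\<pi>\<in>column_stabilizer n (permute_tableau \<sigma> t).
      of_int (sign \<pi>) * of_bool (T = tabloid n (permute_tableau \<pi> (permute_tableau \<sigma> t))))"
  proof (rule sum.reindex_bij_witness[of _ "\<lambda>\<pi>. inv \<sigma> \<circ> \<pi> \<circ> inv (inv \<sigma>)" "\<lambda>\<pi>. \<sigma> \<circ> \<pi> \<circ> inv \<sigma>"])
    note inv_inv = permutes_inv_inv[OF \<sigma>]
    fix \<pi>
    show "inv \<sigma> \<circ> (\<sigma> \<circ> \<pi> \<circ> inv \<sigma>) \<circ> inv (inv \<sigma>) = \<pi>"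
      unfolding inv_inv using permutes_inverses[OF \<sigma>] by (simp add: fun_eq_iff)
    show "\<sigma> \<circ> (inv \<sigma> \<circ> \<pi> \<circ> inv (inv \<sigma>)) \<circ> inv \<sigma> = \<pi>"
      unfolding inv_inv using permutes_inverses[OF \<sigma>] by (simp add: fun_eq_iff)
    show "\<sigma> \<circ> \<pi> \<circ> inv \<sigma> \<in> column_stabilizer n (permute_tableau \<sigma> t)"
      if "\<pi> \<in> column_stabilizer n t"
      by (rule column_stabilizer_conj[OF \<sigma> that])
    show "inv \<sigma> \<circ> \<pi> \<circ> inv (inv \<sigma>) \<in> column_stabilizer n t"
      if "\<pi> \<in> column_stabilizer n (permute_tableau \<sigma> t)"
      using column_stabilizer_conj[OF permutes_inv[OF \<sigma>] that]
      unfolding permute_tableau_inv[OF \<sigma>] .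
    assume "\<pi> \<in> column_stabilizer n t"
    then have "\<pi> permutes {1..n}" by (simp add: column_stabilizer_def)
    then have "sign (\<sigma> \<circ> \<pi> \<circ> inv \<sigma>) = sign \<pi>"
      by (intro sign_conj[OF \<sigma>]) auto
    moreover have "permute_tableau (\<sigma> \<circ> \<pi> \<circ> inv \<sigma>) (permute_tableau \<sigma> t) = permute_tableau (\<sigma> \<circ> \<pi>) t"
      unfolding permute_tableau_comp permute_tableau_inv[OF \<sigma>] ..
    ultimately show "of_int (sign (\<sigma> \<circ> \<pi> \<circ> inv \<sigma>)) *
        of_bool (T = tabloid n (permute_tableau (\<sigma> \<circ> \<pi> \<circ> inv \<sigma>) (permute_tableau \<sigma> t)))
      = (of_int (sign \<pi>) * of_bool (T = tabloid n (permute_tableau (\<sigma> \<circ> \<pi>) t)) :: complex)"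
      by (simp only:)
  qed
  finally show "permute_vec \<sigma> (polytabloid n t) T = polytabloid n (permute_tableau \<sigma> t) T"
    by (simp only: polytabloid_def)
qed

lemma linear_permute_vec: "Vector_Spaces.linear scale_fun scale_fun (permute_vec \<sigma>)"
  by unfold_locales (simp_all add: permute_vec_def scale_fun_def fun_eq_iff)

lemma permute_vec_specht:
  assumes "\<sigma> permutes {1..n}" "v \<in> specht n \<alpha>"
  shows "permute_vec \<sigma> v \<in> specht n \<alpha>"
proof -
  interpret lin: Vector_Spaces.linear scale_fun scale_fun "permute_vec \<sigma>"
    by (rule linear_permute_vec)
  have "permute_vec \<sigma> ` specht n \<alpha> = fun_vs.span (permute_vec \<sigma> ` polytabloid n ` tableaux n \<alpha>)"
    unfolding specht_def by (rule lin.span_image[symmetric])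
  also have "\<dots> \<subseteq> specht n \<alpha>"
    unfolding specht_def
    by (intro fun_vs.span_mono)
      (auto simp: permute_vec_polytabloid[OF assms(1)] intro!: imageI permute_tableau_in_tableaux[OF assms(1)])
  finally show ?thesis using assms(2) by blast
qed

lemma finite_tableaux: "finite (tableaux n \<alpha>)"
proof -
  have "tableaux n \<alpha> \<subseteq> {t. set t \<subseteq> {r. set r \<subseteq> {1..n} \<and> length r \<le> n} \<and> length t = length \<alpha>}"
  proof
    fix t assume t: "t \<in> tableaux n \<alpha>"
    have "set r \<subseteq> {1..n} \<and> length r \<le> n" if "r \<in> set t" for r
    proof -
      have r: "distinct r" "set r \<subseteq> {1..n}"
        using t that by (auto simp: tableaux_def distinct_concat_iff)
      then show ?thesis
        using card_mono[OF _ r(2)] distinct_card[OF r(1)] by simp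
    qed
    moreover have "length t = length \<alpha>" using t by (auto simp: tableaux_def)
    ultimately show "t \<in> {t. set t \<subseteq> {r. set r \<subseteq> {1..n} \<and> length r \<le> n} \<and> length t = length \<alpha>}"
      by blast
  qed
  moreover have "finite {r :: nat list. set r \<subseteq> {1..n} \<and> length r \<le> n}"
    by (rule finite_lists_length_le) simp
  then have "finite {t. set t \<subseteq> {r :: nat list. set r \<subseteq> {1..n} \<and> length r \<le> n} \<and> length t = length \<alpha>}"
    by (rule finite_lists_length_eq)
  ultimately show ?thesis by (rule finite_subset)
qed

definition tabloids :: "nat \<Rightarrow> nat list \<Rightarrow> nat list list set set" where
  "tabloids n \<alpha> = tabloid n ` tableaux n \<alpha>"

lemma permute_tabloids:
  assumes "\<sigma> permutes {1..n}" "T \<in> tabloids n \<alpha>"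
  shows "permute_tableau \<sigma> ` T \<in> tabloids n \<alpha>"
  using assms permute_tableau_in_tableaux[OF assms(1)]
  by (auto simp: tabloids_def permute_tableau_tabloid)

lemma polytabloid_supported:
  assumes "t \<in> tableaux n \<alpha>" "T \<notin> tabloids n \<alpha>"
  shows "polytabloid n t T = 0"
  unfolding polytabloid_def
proof (rule sum.neutral, rule ballI)
  fix \<pi> assume "\<pi> \<in> column_stabilizer n t"
  then have "tabloid n (permute_tableau \<pi> t) \<in> tabloids n \<alpha>"
    using permute_tableau_in_tableaux[OF _ assms(1)] by (auto simp: column_stabilizer_def tabloids_def)
  then show "complex_of_int (sign \<pi>) * of_bool (T = tabloid n (permute_tableau \<pi> t)) = 0"
    using assms(2) by auto
qed

text \<open>The same basis serves all \<open>\<sigma>\<close> at once, which allows the sum over the group to be exchanged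
  with the sum over the basis.\<close>

lemma irr_char_orthonormal:
  obtains C where "finite C" "orthonormal_on (tabloids n \<alpha>) C id"
    "\<And>\<sigma>. \<sigma> permutes {1..n} \<Longrightarrow>
      irr_char n \<alpha> \<sigma> = (\<Sum>c\<in>C. inner_on (tabloids n \<alpha>) c (permute_vec \<sigma> c))"
proof -
  have "finite (tabloids n \<alpha>)" by (simp add: tabloids_def finite_tableaux)
  then have "\<exists>C. finite C \<and> orthonormal_on (tabloids n \<alpha>) C id \<and>
      fun_vs.span C = fun_vs.span (polytabloid n ` tableaux n \<alpha>)"
    by (rule Gram_Schmidt) (use polytabloid_supported in \<open>auto simp: finite_tableaux\<close>)
  then obtain C where C: "finite C" "orthonormal_on (tabloids n \<alpha>) C id"
    "fun_vs.span C = specht n \<alpha>" unfolding specht_def by blast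
  have "irr_char n \<alpha> \<sigma> = (\<Sum>c\<in>C. inner_on (tabloids n \<alpha>) c (permute_vec \<sigma> c))"
    if "\<sigma> permutes {1..n}" for \<sigma>
    unfolding irr_char_def C(3)[symmetric]
    by (rule trace_on_orthonormal[OF C(2,1) linear_permute_vec])
      (simp add: C(3) permute_vec_specht[OF that])
  then show ?thesis using that C by blast
qed

section \<open>Rows of a tabloid\<close>

text \<open>All members of a tabloid have the same row sets, so on tabloids \<open>row_of T x\<close> is the unique row
  containing \<open>x\<close> (\<open>row_of_tabloid\<close>). Taking the least such row over all members makes the function
  total and its equivariance immediate for arbitrary \<open>T\<close>.\<close>

definition row_of :: "nat list list set \<Rightarrow> nat \<Rightarrow> nat" where
  "row_of T x = (LEAST i. \<exists>s\<in>T. i < length s \<and> x \<in> set (s ! i))"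

lemma row_of_permute:
  assumes "\<sigma> permutes A"
  shows "row_of (permute_tableau \<sigma> ` T) (\<sigma> x) = row_of T x"
proof -
  have "(\<exists>s\<in>permute_tableau \<sigma> ` T. i < length s \<and> \<sigma> x \<in> set (s ! i))
      \<longleftrightarrow> (\<exists>s\<in>T. i < length s \<and> x \<in> set (s ! i))" for i
    using permutes_inj[OF assms] by (auto simp: inj_image_mem_iff)
  then show ?thesis by (simp add: row_of_def)
qed

lemma in_set_concat_iff_nth: "x \<in> set (concat t) \<longleftrightarrow> (\<exists>i<length t. x \<in> set (t ! i))"
  unfolding set_concat set_conv_nth[of t] by auto

lemma distinct_concat_nth_unique:
  assumes "distinct (concat t)" "i < length t" "j < length t" "x \<in> set (t ! i)" "x \<in> set (t ! j)"
  shows "i = j"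
  using assms
proof (induction t arbitrary: i j)
  case (Cons r t)
  have "x \<notin> set r" if "k < length t" "x \<in> set (t ! k)" for k
    using Cons.prems(1) that in_set_concat_iff_nth[of x t] by (auto simp del: set_concat)
  then show ?case
    using Cons.prems Cons.IH by (cases i; cases j) auto
qed simp

lemma row_of_tabloid:
  assumes t: "t \<in> tableaux n \<alpha>" and i: "i < length \<alpha>" and x: "x \<in> set (t ! i)"
  shows "row_of (tabloid n t) x = i"
proof -
  have len: "length t = length \<alpha>" using t by (auto simp: tableaux_def)
  have rows: "length s = length t \<and> (\<forall>j<length t. set (s ! j) = set (t ! j))"
    if "s \<in> tabloid n t" for s
    using that by (auto simp: tabloid_def list_eq_iff_nth_eq)
  have dist: "distinct (concat t)" using t by (simp add: tableaux_def)
  have tt: "t \<in> tabloid n t" using t by (auto simp: tabloid_def tableaux_def)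
  have "(\<exists>s\<in>tabloid n t. j < length s \<and> x \<in> set (s ! j)) \<longleftrightarrow> j = i" for j
  proof
    assume "\<exists>s\<in>tabloid n t. j < length s \<and> x \<in> set (s ! j)"
    then have "j < length t" "x \<in> set (t ! j)" using rows by auto
    then show "j = i"
      using distinct_concat_nth_unique[OF dist, of j i x] i x len by simp
  next
    assume "j = i"
    then show "\<exists>s\<in>tabloid n t. j < length s \<and> x \<in> set (s ! j)"
      using tt i x len by (intro bexI[of _ t]) auto
  qed
  then show ?thesis unfolding row_of_def by (auto intro: Least_equality)
qed

lemma row_of_less:
  assumes "T \<in> tabloids n \<alpha>" "x \<in> {1..n}"
  shows "row_of T x < length \<alpha>"
proof -
  obtain t where t: "T = tabloid n t" "t \<in> tableaux n \<alpha>" using assms by (auto simp: tabloids_def)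
  then have "x \<in> set (concat t)" "length t = length \<alpha>" using assms(2) by (auto simp: tableaux_def)
  then obtain i where "i < length \<alpha>" "x \<in> set (t ! i)"
    using in_set_concat_iff_nth[of x t] by auto
  then show ?thesis using row_of_tabloid[OF t(2)] t(1) by simp
qed

text \<open>The row sets of a tableau are the fibres of the row function, and a tabloid is determined by
  its row sets.\<close>

lemma tabloid_eqI:
  assumes "T \<in> tabloids n \<alpha>" "T' \<in> tabloids n \<alpha>"
    and "\<And>x. x \<in> {1..n} \<Longrightarrow> row_of T x = row_of T' x"
  shows "T = T'"
proof -
  obtain t t' where t: "T = tabloid n t" "t \<in> tableaux n \<alpha>" "T' = tabloid n t'" "t' \<in> tableaux n \<alpha>"
    using assms by (auto simp: tabloids_def)
  have len: "length s = length \<alpha>" if "s \<in> tableaux n \<alpha>" for s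
    using that by (auto simp: tableaux_def)
  have row: "set (s ! i) = {x \<in> {1..n}. row_of (tabloid n s) x = i}"
    if s: "s \<in> tableaux n \<alpha>" and i: "i < length \<alpha>" for s i
  proof (intro equalityI subsetI)
    fix x assume "x \<in> set (s ! i)"
    moreover from this have "x \<in> set (concat s)"
      using i len[OF s] in_set_concat_iff_nth[of x s] by auto
    ultimately show "x \<in> {x \<in> {1..n}. row_of (tabloid n s) x = i}"
      using row_of_tabloid[OF s i] s by (auto simp: tableaux_def)
  next
    fix x assume x: "x \<in> {x \<in> {1..n}. row_of (tabloid n s) x = i}"
    then have "x \<in> set (concat s)" using s by (auto simp: tableaux_def)
    then obtain j where "j < length \<alpha>" "x \<in> set (s ! j)"
      using len[OF s] in_set_concat_iff_nth[of x s] by auto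
    then show "x \<in> set (s ! i)" using row_of_tabloid[OF s] x by auto
  qed
  have "map set t = map set t'"
  proof (rule nth_equalityI)
    show "length (map set t) = length (map set t')" using t len by simp
    fix i assume "i < length (map set t)"
    then have i: "i < length \<alpha>" using t len by simp
    then have "set (t ! i) = set (t' ! i)"
      unfolding row[OF t(2) i] row[OF t(4) i] using assms(3) t by auto
    then show "map set t ! i = map set t' ! i" using i t len by simp
  qed
  moreover have "map length t = map length t'" using t by (simp add: tableaux_def)
  ultimately show ?thesis by (simp add: t tabloid_def)
qed

section \<open>Triples of tabloids\<close>

type_synonym tabloid_triple = "nat list list set \<times> nat list list set \<times> nat list list set"

definition triples :: "nat \<Rightarrow> nat list \<Rightarrow> nat list \<Rightarrow> nat list \<Rightarrow> tabloid_triple set" where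
  "triples n lam mu nu = tabloids n lam \<times> tabloids n mu \<times> tabloids n nu"

definition permute_triple :: "(nat \<Rightarrow> nat) \<Rightarrow> tabloid_triple \<Rightarrow> tabloid_triple" where
  "permute_triple \<sigma> = (\<lambda>(T, U, V). (permute_tableau \<sigma> ` T, permute_tableau \<sigma> ` U, permute_tableau \<sigma> ` V))"

definition rows_of :: "tabloid_triple \<Rightarrow> nat \<Rightarrow> nat \<times> nat \<times> nat" where
  "rows_of = (\<lambda>(T, U, V) x. (row_of T x, row_of U x, row_of V x))"

text \<open>The multiplicity of \<open>(i, j, l)\<close> is the number of elements lying in row \<open>i\<close>, row \<open>j\<close> and row \<open>l\<close> of
  the three tabloids: a three-dimensional contingency table, represented as a multiset of cells.\<close>

definition contingency :: "nat \<Rightarrow> tabloid_triple \<Rightarrow> (nat \<times> nat \<times> nat) multiset" where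
  "contingency n w = image_mset (rows_of w) (mset_set {1..n})"

lemma rows_of_permute: "\<sigma> permutes A \<Longrightarrow> rows_of (permute_triple \<sigma> w) (\<sigma> x) = rows_of w x"
  by (cases w) (simp add: rows_of_def permute_triple_def row_of_permute)

lemma permute_triple_closed:
  "\<sigma> permutes {1..n} \<Longrightarrow> w \<in> triples n lam mu nu \<Longrightarrow> permute_triple \<sigma> w \<in> triples n lam mu nu"
  by (auto simp: triples_def permute_triple_def permute_tabloids)

lemma triple_eqI:
  assumes "w \<in> triples n lam mu nu" "w' \<in> triples n lam mu nu"
    and "\<And>x. x \<in> {1..n} \<Longrightarrow> rows_of w x = rows_of w' x"
  shows "w = w'"
proof -
  obtain T U V T' U' V' where w: "w = (T, U, V)" "w' = (T', U', V')" by (metis prod_cases3)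
  have mem: "T \<in> tabloids n lam" "U \<in> tabloids n mu" "V \<in> tabloids n nu"
    "T' \<in> tabloids n lam" "U' \<in> tabloids n mu" "V' \<in> tabloids n nu"
    using assms(1,2) by (simp_all add: w triples_def)
  have rows: "row_of T x = row_of T' x" "row_of U x = row_of U' x" "row_of V x = row_of V' x"
    if "x \<in> {1..n}" for x
    using assms(3)[OF that] by (simp_all add: w rows_of_def)
  show ?thesis
    using tabloid_eqI[OF mem(1,4)] tabloid_eqI[OF mem(2,5)] tabloid_eqI[OF mem(3,6)] rows
    by (simp add: w)
qed

text \<open>The contingency table is a complete invariant of the orbits: if two row assignments have equally
  many elements in every cell, some permutation carries one to the other, and triples of tabloids
  with the same row assignment coincide.\<close>

interpretation triples: permutation_action "{1..n}" "triples n lam mu nu" permute_triple "contingency n"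
  for n lam mu nu
proof
  show "finite (triples n lam mu nu)"
    by (simp add: triples_def tabloids_def finite_tableaux)
  show "permute_triple id w = w" for w
    by (cases w) (simp add: permute_triple_def)
  show "permute_triple (\<sigma> \<circ> \<tau>) w = permute_triple \<sigma> (permute_triple \<tau> w)" for \<sigma> \<tau> w
    by (cases w) (simp only: permute_triple_def prod.case permute_tableau_tabloids_comp)
  show "contingency n (permute_triple \<sigma> w) = contingency n w" if "\<sigma> permutes {1..n}" for \<sigma> w
  proof -
    have "contingency n (permute_triple \<sigma> w)
        = image_mset (rows_of (permute_triple \<sigma> w)) (image_mset \<sigma> (mset_set {1..n}))"
      using permutes_image[OF that] permutes_inj_on[OF that]
      by (simp add: contingency_def image_mset_mset_set del: image_mset.compositionality)
    also have "\<dots> = contingency n w"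
      by (simp add: contingency_def multiset.map_comp comp_def rows_of_permute[OF that])
    finally show ?thesis .
  qed
  show "\<exists>\<sigma>. \<sigma> permutes {1..n} \<and> permute_triple \<sigma> w = w'"
    if w: "w \<in> triples n lam mu nu" "w' \<in> triples n lam mu nu" "contingency n w = contingency n w'"
    for w w'
  proof -
    obtain \<sigma> where \<sigma>: "\<sigma> permutes {1..n}" "\<forall>x\<in>{1..n}. rows_of w x = rows_of w' (\<sigma> x)"
      using image_mset_eq_implies_permutes[of "{1..n}" "rows_of w" "rows_of w'"] w(3)
      by (auto simp: contingency_def)
    have "rows_of (permute_triple \<sigma> w) x = rows_of w' x" if "x \<in> {1..n}" for x
    proof -
      have "x \<in> \<sigma> ` {1..n}" using that by (simp only: permutes_image[OF \<sigma>(1)])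
      then obtain y where y: "y \<in> {1..n}" "x = \<sigma> y" by (rule imageE)
      show ?thesis
        using \<sigma>(2) y(1) unfolding y(2) rows_of_permute[OF \<sigma>(1)] by (rule bspec)
    qed
    then show ?thesis
      using \<sigma>(1) triple_eqI[OF permute_triple_closed[OF \<sigma>(1) w(1)] w(2)] by blast
  qed
qed (simp_all add: permute_triple_closed)

lemma sum_product_triple:
  fixes f g h :: "_ \<Rightarrow> complex"
  shows "(\<Sum>(x, y, z)\<in>X \<times> Y \<times> Z. f x * (g y * h z)) = sum f X * (sum g Y * sum h Z)"
proof -
  have "sum f X * (sum g Y * sum h Z) = (\<Sum>x\<in>X. \<Sum>y\<in>Y. \<Sum>z\<in>Z. f x * (g y * h z))"
    by (subst sum_product[of g], subst sum_product) (simp only: sum_distrib_left)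
  then show ?thesis by (simp only: sum.cartesian_product)
qed

lemma inner_on_triples:
  "inner_on (X \<times> Y \<times> Z) (\<lambda>w. a (fst w) * b (fst (snd w)) * c (snd (snd w)))
      (\<lambda>w. a' (fst w) * b' (fst (snd w)) * c' (snd (snd w)))
    = inner_on X a a' * inner_on Y b b' * inner_on Z c c'"
proof -
  have "inner_on X a a' * inner_on Y b b' * inner_on Z c c'
      = (\<Sum>(x, y, z)\<in>X \<times> Y \<times> Z. (cnj (a x) * a' x) * ((cnj (b y) * b' y) * (cnj (c z) * c' z)))"
    unfolding sum_product_triple inner_on_def by (rule mult.assoc)
  then show ?thesis
    unfolding inner_on_def by (simp add: case_prod_beta mult_ac)
qed

text \<open>The product of the three characters at \<open>\<sigma>\<close> is the trace of \<open>\<sigma>\<close> in the orthonormal family of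
  products \<open>a \<otimes> b \<otimes> c\<close>, so that the orbit bound applies to this family.\<close>

lemma kronecker_le_card_contingency:
  "kronecker n lam mu nu \<le> of_nat (card (contingency n ` triples n lam mu nu))"
proof -
  obtain C1 where C1: "finite C1" "orthonormal_on (tabloids n lam) C1 id"
    "\<And>\<sigma>. \<sigma> permutes {1..n} \<Longrightarrow>
      irr_char n lam \<sigma> = (\<Sum>c\<in>C1. inner_on (tabloids n lam) c (permute_vec \<sigma> c))"
    by (rule irr_char_orthonormal[of n lam]) (rule that)
  obtain C2 where C2: "finite C2" "orthonormal_on (tabloids n mu) C2 id"
    "\<And>\<sigma>. \<sigma> permutes {1..n} \<Longrightarrow>
      irr_char n mu \<sigma> = (\<Sum>c\<in>C2. inner_on (tabloids n mu) c (permute_vec \<sigma> c))"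
    by (rule irr_char_orthonormal[of n mu]) (rule that)
  obtain C3 where C3: "finite C3" "orthonormal_on (tabloids n nu) C3 id"
    "\<And>\<sigma>. \<sigma> permutes {1..n} \<Longrightarrow>
      irr_char n nu \<sigma> = (\<Sum>c\<in>C3. inner_on (tabloids n nu) c (permute_vec \<sigma> c))"
    by (rule irr_char_orthonormal[of n nu]) (rule that)
  define e :: "tabloid_vec \<times> tabloid_vec \<times> tabloid_vec \<Rightarrow> tabloid_triple \<Rightarrow> complex"
    where "e = (\<lambda>(a, b, c) w. a (fst w) * b (fst (snd w)) * c (snd (snd w)))"
  let ?W = "triples n lam mu nu" and ?I = "C1 \<times> C2 \<times> C3"
  have e: "orthonormal_on ?W ?I e"
    unfolding orthonormal_on_def
  proof (intro ballI)
    fix i j assume "i \<in> ?I" "j \<in> ?I"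
    then obtain a b c a' b' c' where ij: "i = (a, b, c)" "j = (a', b', c')"
      and "a \<in> C1" "b \<in> C2" "c \<in> C3" "a' \<in> C1" "b' \<in> C2" "c' \<in> C3" by blast
    then have on: "inner_on (tabloids n lam) a a' = of_bool (a = a')"
      "inner_on (tabloids n mu) b b' = of_bool (b = b')"
      "inner_on (tabloids n nu) c c' = of_bool (c = c')"
      using C1(2) C2(2) C3(2) by (simp_all add: orthonormal_on_def)
    have "inner_on ?W (e i) (e j) = inner_on (tabloids n lam) a a'
        * inner_on (tabloids n mu) b b' * inner_on (tabloids n nu) c c'"
      unfolding ij e_def triples_def prod.case inner_on_triples ..
    then show "inner_on ?W (e i) (e j) = of_bool (i = j)"
      unfolding on ij by simp
  qed
  have char: "irr_char n lam \<sigma> * irr_char n mu \<sigma> * irr_char n nu \<sigma>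
      = (\<Sum>i\<in>?I. inner_on ?W (e i) (\<lambda>w. e i (permute_triple (inv \<sigma>) w)))"
    if \<sigma>: "\<sigma> permutes {1..n}" for \<sigma>
  proof -
    have "(\<Sum>i\<in>?I. inner_on ?W (e i) (\<lambda>w. e i (permute_triple (inv \<sigma>) w)))
        = (\<Sum>(a, b, c)\<in>?I. inner_on (tabloids n lam) a (permute_vec \<sigma> a)
          * inner_on (tabloids n mu) b (permute_vec \<sigma> b) * inner_on (tabloids n nu) c (permute_vec \<sigma> c))"
      unfolding triples_def inner_on_triples[symmetric]
      by (simp only: e_def permute_triple_def permute_vec_def split_def fst_conv snd_conv)
    also have "\<dots> = irr_char n lam \<sigma> * irr_char n mu \<sigma> * irr_char n nu \<sigma>"
      unfolding C1(3)[OF \<sigma>] C2(3)[OF \<sigma>] C3(3)[OF \<sigma>]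
      unfolding mult.assoc by (simp only: sum_product_triple)
    finally show ?thesis by simp
  qed
  have "kronecker n lam mu nu = (\<Sum>\<sigma> | \<sigma> permutes {1..n}.
      \<Sum>i\<in>?I. inner_on ?W (e i) (\<lambda>w. e i (permute_triple (inv \<sigma>) w))) / fact (card {1..n})"
    unfolding kronecker_def using char by simp
  also have "\<dots> \<le> of_nat (card (contingency n ` ?W))"
    by (rule triples.invariant_dimension_le_fibres[OF e]) (simp add: C1 C2 C3)
  finally show ?thesis .
qed

section \<open>Counting contingency tables\<close>

text \<open>Raising \<open>K\<close> by one multiplies the left-hand side by \<open>(K + n) / K\<close>, which is at most \<open>n\<close> when
  \<open>n, K \<ge> 2\<close>; the step from \<open>K = 1\<close> to \<open>K = 2\<close> multiplies it by \<open>n + 1\<close>, so the induction starts at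
  \<open>K = 2\<close>. For \<open>n = 1\<close> the left-hand side is \<open>K\<close>, so the bound fails for \<open>K > 1\<close>.\<close>

lemma binomial_le_power:
  assumes "n \<ge> 1" "K \<ge> 1" "n \<ge> 2 \<or> K = 1"
  shows "(K + n - 1) choose n \<le> n ^ K"
proof (cases "K = 1")
  case True
  then show ?thesis using assms by simp
next
  case False
  then have n: "n \<ge> 2" and "K \<ge> 2" using assms by auto
  from \<open>K \<ge> 2\<close> show ?thesis
  proof (induction K rule: dec_induct)
    case base
    have "n + 1 \<le> n * n" using mult_le_mono[of 2 n n n] n by linarith
    then show ?case by (simp add: power2_eq_square)
  next
    case (step K)
    have "K * ((K + n) choose n) = (K + n) * ((K + n - 1) choose n)"
      using binomial_absorb_comp[of "K + n" n] by simp
    also have "\<dots> \<le> (K * n) * n ^ K"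
    proof (rule mult_mono)
      obtain p q where "K = Suc (Suc p)" "n = Suc (Suc q)"
        using step.hyps n by (metis add_2_eq_Suc le_Suc_ex)
      then show "K + n \<le> K * n" by simp
    qed (use step.IH in auto)
    finally have "K * ((K + n) choose n) \<le> K * n ^ Suc K" by (simp add: mult.assoc)
    then show ?case using step.hyps by simp
  qed
qed

lemma card_contingency_le:
  "card (contingency n ` triples n lam mu nu)
    \<le> (length lam * length mu * length nu + n - 1) choose n"
proof -
  let ?D = "{..<length lam} \<times> {..<length mu} \<times> {..<length nu}"
  have "contingency n ` triples n lam mu nu \<subseteq> multisets_of_size ?D n"
    by (auto simp: contingency_def multisets_of_size_def triples_def rows_of_def row_of_less)
  then have "card (contingency n ` triples n lam mu nu) \<le> card (multisets_of_size ?D n)"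
    by (intro card_mono) auto
  also have "\<dots> = (card ?D + n - 1) choose n"
    by (rule card_multisets_of_size) simp
  also have "card ?D = length lam * length mu * length nu"
    by (simp add: mult.assoc)
  finally show ?thesis .
qed

text \<open>For \<open>n = 1\<close> these bounds force length 1, and so a single cell, which is the one case with \<open>n = 1\<close>
  that \<open>binomial_le_power\<close> covers.\<close>

lemma length_partition_bounds:
  assumes "\<alpha> \<turnstile>p n" "n \<ge> 1"
  shows "1 \<le> length \<alpha>" "length \<alpha> \<le> n"
proof -
  show "1 \<le> length \<alpha>" using assms by (cases \<alpha>) (auto simp: is_partition_def)
  have "length \<alpha> \<le> sum_list \<alpha>" if "0 \<notin> set \<alpha>"
    using that by (induction \<alpha>) auto
  then show "length \<alpha> \<le> n" using assms by (auto simp: is_partition_def)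
qed

theorem corollary1p2:
  fixes n k :: nat and lam mu nu :: "nat list"
  assumes "n \<ge> 1" and "k \<ge> 1"
    and "lam \<turnstile>p n" and "mu \<turnstile>p n" and "nu \<turnstile>p n"
    and "length lam \<le> k" and "length mu \<le> k" and "length nu \<le> k"
  shows "kronecker n lam mu nu \<le> (of_nat n :: complex) ^ (k ^ 3)"
proof -
  define K where "K = length lam * length mu * length nu"
  note len = length_partition_bounds[OF assms(3) assms(1)] length_partition_bounds[OF assms(4) assms(1)]
    length_partition_bounds[OF assms(5) assms(1)]
  have "K \<ge> 1" using len by (simp add: K_def)
  have "K \<le> k ^ 3"
    unfolding K_def power3_eq_cube using assms(6-8) by (intro mult_mono) auto
  have "n \<ge> 2 \<or> K = 1"
  proof (cases "n = 1")
    case True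
    then have "length lam = 1" "length mu = 1" "length nu = 1" using len by auto
    then show ?thesis by (simp add: K_def)
  qed (use assms(1) in auto)
  then have "card (contingency n ` triples n lam mu nu) \<le> n ^ K"
    using card_contingency_le[of n lam mu nu] binomial_le_power[OF assms(1) \<open>K \<ge> 1\<close>]
    by (simp add: K_def)
  also have "\<dots> \<le> n ^ (k ^ 3)"
    using \<open>K \<le> k ^ 3\<close> assms(1) by (rule power_increasing)
  finally have "(of_nat (card (contingency n ` triples n lam mu nu)) :: complex) \<le> of_nat (n ^ (k ^ 3))"
    by (simp add: less_eq_complex_def del: of_nat_power)
  then show ?thesis
    using order_trans[OF kronecker_le_card_contingency] by simp
qed

end
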